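(* Let $a,b>0$, $x_0\in\mathbb{R}$, and let $\mathcal{A}$, $\mathcal{B}$, the (general) minimax risk $R(n,\mathcal{A},\mathcal{B})$ over all estimators and the CFD estimator $\bar L_n$ be as defined in the context. Then for every integer $n\ge1$, $$R(n,\mathcal{A},\mathcal{B})\ \ge\ \frac{1}{16}e^{-2/3}\left(\frac{3ab}{n}\right)^{2/3}.$$ Consequently, the CFD estimator is optimal up to a constant multiplicative factor: there is an absolute constant $C$ (independent of $n,a,b,x_0$) such that for every even $n$, the CFD estimator $\bar L_n$ with $\delta=\left(\frac{18b}{a^2}\right)^{1/6}n^{-1/6}$ satisfies $$\sup_{f\in\mathcal{A},\ \sigma^2\in\mathcal{B}}E\big(\bar L_n-f'(x_0)\big)^2\le C\,R(n,\mathcal{A},\mathcal{B}).$$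
   Context: Setting. $f:\mathbb{R}\to\mathbb{R}$ is an unknown function; at any chosen $x\in\mathbb{R}$ one can observe a random variable with mean $f(x)$ and variance $\sigma^2(x)$. The goal is to estimate $f'(x_0)$. With budget $n\ge1$, one chooses deterministic design points $x_1,\dots,x_n\in\mathbb{R}$ (repetitions allowed) and observes independent outputs $Y_1,\dots,Y_n$, where $Y_j=Y_j(x_j)$ has mean $f(x_j)$ and variance $\sigma^2(x_j)$. An estimator is any measurable function $\widehat\theta=\widehat\theta(Y_1,\dots,Y_n)\in\mathbb{R}$ (no linearity is assumed). Problem classes, for given constants $a,b>0$: $\mathcal{A}$ is the set of functions $f:\mathbb{R}\to\mathbb{R}$ such that $f^{(2)}(x_0)$ exists and, for all $x\in\mathbb{R}$, $$\left|f(x)-f(x_0)-f'(x_0)(x-x_0)-\tfrac{f^{(2)}(x_0)}{2}(x-x_0)^2\right|\le\tfrac{a}{6}|x-x_0|^3 .$$ $\mathcal{B}$ is the set of variance functions $\sigma^2:\mathbb{R}\to[0,\infty)$ with $\sigma^2(x)\le b$ for all $x$. Minimax risk: $$R(n,\mathcal{A},\mathcal{B})=\inf_{x_1,\dots,x_n,\ \widehat\theta}\ \ \sup_{f\in\mathcal{A},\ \sigma^2\in\mathcal{B}}E\big(\widehat\theta-f'(x_0)\big)^2 ,$$ where the supremum is understood to range also over all laws of the independent outputs compatible with $f$ and $\sigma^2$ (means $f(x_j)$, variances $\sigma^2(x_j)$); in particular Gaussian noise is included. CFD estimator ($n$ even, $\delta>0$), based on independent outputs, $n/2$ of them at each of $x_0+\delta$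 and $x_0-\delta$: $$\bar L_n=\frac{1}{n/2}\sum_{j=1}^{n/2}\frac{Y_{2j-1}(x_0+\delta)-Y_{2j}(x_0-\delta)}{2\delta}.$$ *)

theory Defs
  imports "HOL-Probability.Probability"
begin

definition smooth_class :: "real \<Rightarrow> real \<Rightarrow> (real \<Rightarrow> real) set" where
  "smooth_class a x0 = {f.
     (\<forall>\<^sub>F x in nhds x0. f differentiable (at x)) \<and>
     deriv f differentiable (at x0) \<and>
     (\<forall>x. \<bar>f x - f x0 - deriv f x0 * (x - x0) - deriv (deriv f) x0 / 2 * (x - x0)^2\<bar>
            \<le> a / 6 * \<bar>x - x0\<bar>^3)}"

definition variance_class :: "real \<Rightarrow> (real \<Rightarrow> real) set" where
  "variance_class b = {v. \<forall>x. 0 \<le> v x \<and> v x \<le> b}"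

(* The possible joint laws of the outputs (Y_1, ..., Y_n) at the design points d 1, ..., d n, with
   v the variance function. The marginals are otherwise unrestricted and need not coincide at
   repeated design points. Integrability is explicit because the Bochner integral of a
   non-integrable function is 0. *)
definition output_laws ::
  "nat \<Rightarrow> (real \<Rightarrow> real) \<Rightarrow> (real \<Rightarrow> real) \<Rightarrow> (nat \<Rightarrow> real) \<Rightarrow> (nat \<Rightarrow> real) measure set" where
  "output_laws n f v d = {P.
     prob_space P \<and>
     sets P = sets (Pi\<^sub>M {1..n} (\<lambda>_. borel)) \<and>
     prob_space.indep_vars P (\<lambda>_. borel) (\<lambda>j y. y j) {1..n} \<and>
     (\<forall>j\<in>{1..n}.
        integrable P (\<lambda>y. y j) \<and> integrable P (\<lambda>y. (y j)^2) \<and>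
        (\<integral>y. y j \<partial>P) = f (d j) \<and>
        (\<integral>y. (y j - f (d j))^2 \<partial>P) = v (d j))}"

definition estimators :: "nat \<Rightarrow> ((nat \<Rightarrow> real) \<Rightarrow> real) set" where
  "estimators n = borel_measurable (Pi\<^sub>M {1..n} (\<lambda>_. borel))"

(* Risks take values in ennreal, since the mean squared error of an estimator may be infinite. *)
definition worst_case_mse ::
  "real \<Rightarrow> real \<Rightarrow> real \<Rightarrow> nat \<Rightarrow> (nat \<Rightarrow> real) \<Rightarrow> ((nat \<Rightarrow> real) \<Rightarrow> real) \<Rightarrow> ennreal" where
  "worst_case_mse a b x0 n d \<theta> =
     (SUP f\<in>smooth_class a x0. SUP v\<in>variance_class b. SUP P\<in>output_laws n f v d.
        \<integral>\<^sup>+ y. ennreal ((\<theta> y - deriv f x0)^2) \<partial>P)"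

definition minimax_risk :: "real \<Rightarrow> real \<Rightarrow> real \<Rightarrow> nat \<Rightarrow> ennreal" where
  "minimax_risk a b x0 n = (INF d. INF \<theta>\<in>estimators n. worst_case_mse a b x0 n d \<theta>)"

definition cfd_design :: "real \<Rightarrow> real \<Rightarrow> nat \<Rightarrow> real" where
  "cfd_design x0 \<delta> j = (if odd j then x0 + \<delta> else x0 - \<delta>)"

definition cfd_estimator :: "nat \<Rightarrow> real \<Rightarrow> (nat \<Rightarrow> real) \<Rightarrow> real" where
  "cfd_estimator n \<delta> y =
     1 / (real n / 2) * (\<Sum>j=1..n div 2. (y (2 * j - 1) - y (2 * j)) / (2 * \<delta>))"

definition cfd_delta :: "real \<Rightarrow> real \<Rightarrow> nat \<Rightarrow> real" where
  "cfd_delta a b n = (18 * b / a^2) powr (1/6) * real n powr (-1/6)"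

end

theory Submission
  imports Defs
begin

text \<open>
  Lower bound: for small s > 0 the line of slope s through x0, cut off to 0 where the cubic tolerance
  a/6 |x - x0|^3 exceeds it, lies in the class together with its negative, and both are uniformly
  of size O(s^(3/2)). With Gaussian noise of variance b the Hellinger affinity of the two data laws
  is the exponential of minus the sum of the squared values over 2 b, so it stays close to 1 when s
  is a small multiple of (a b / n)^(1/3), whatever the design. Le Cam's two-point argument, in a
  pointwise form for the two densities, then forces a risk of the order of the square of s. The
  upper bound is the bias-variance decomposition with the stated step size.
\<close>

section \<open>A pointwise inequality for two hypotheses\<close>

text \<open>For p + q > 0 the loss is smallest at t = s (p - q) / (p + q), with value 4 s^2 p q / (p
  + q); after adding s^2 (p + q), AM-GM gives the bound. Integrated over two densities, the right
  side becomes two risks plus 2 s^2 and the left side a multiple of the Hellinger affinity.\<close>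

lemma two_point_weighted_loss:
  fixes s t p q :: real
  assumes "p \<ge> 0" "q \<ge> 0"
  shows "4 * s\<^sup>2 * sqrt (p * q) \<le> (t - s)\<^sup>2 * p + (t + s)\<^sup>2 * q + s\<^sup>2 * (p + q)"
proof -
  define u w where "u = sqrt p" and "w = sqrt q"
  define D where "D = p + q"
  have pq: "p = u\<^sup>2" "q = w\<^sup>2" "sqrt (p * q) = u * w"
    using assms by (simp_all add: u_def w_def real_sqrt_mult)
  let ?F = "(t - s)\<^sup>2 * p + (t + s)\<^sup>2 * q + s\<^sup>2 * (p + q) - 4 * s\<^sup>2 * sqrt (p * q)"
  \<comment> \<open>The first square vanishes at the best \<open>t\<close>; the second is the AM-GM
    defect, since \<open>D - 2 * u * w\<close> is (u - w)^2.\<close>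
  have "D * ?F = (t * D - s * (p - q))\<^sup>2 + s\<^sup>2 * (D - 2 * u * w)\<^sup>2"
    unfolding D_def pq(3) unfolding pq(1,2) by algebra
  then have *: "D * ?F \<ge> 0" by simp
  show ?thesis
  proof (cases "D = 0")
    case True
    then have "p = 0" "q = 0" using assms by (auto simp: D_def)
    then show ?thesis by simp
  next
    case False
    then have "D > 0" using assms by (auto simp: D_def)
    with * have "?F \<ge> 0" by (simp only: zero_le_mult_iff) linarith
    then show ?thesis by linarith
  qed
qed

section \<open>Product measures: densities and independence\<close>

text \<open>Boxes determine a finite product measure, and on a box the integrand factorises, so the
  integral does too. Nonnegativity lets \<open>ennreal\<close> pass through the real
  product.\<close>

lemma density_PiM_real:
  fixes p :: "'i \<Rightarrow> 'a \<Rightarrow> real"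
  assumes "finite I" "product_sigma_finite M"
    and p: "\<And>i. i \<in> I \<Longrightarrow> p i \<in> borel_measurable (M i)"
    and nn: "\<And>i x. i \<in> I \<Longrightarrow> p i x \<ge> 0"
    and prob: "\<And>i. prob_space (density (M i) (p i))"
  shows "density (PiM I M) (\<lambda>x. \<Prod>i\<in>I. p i (x i)) = PiM I (\<lambda>i. density (M i) (p i))"
proof -
  interpret product_sigma_finite M by fact
  interpret N: product_prob_space "\<lambda>i. density (M i) (p i)" I
    using prob by (rule product_prob_spaceI)
  note p[measurable]
  show ?thesis
  proof (rule N.PiM_eqI)
    show "finite I" by fact
    show "sets (density (PiM I M) (\<lambda>x. \<Prod>i\<in>I. p i (x i))) = sets (PiM I (\<lambda>i. density (M i) (p i)))"
      by (simp cong: sets_PiM_cong)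
    fix A assume A: "\<And>i. i \<in> I \<Longrightarrow> A i \<in> sets (density (M i) (p i))"
    have [measurable]: "(\<lambda>x. ennreal (\<Prod>i\<in>I. p i (x i))) \<in> borel_measurable (PiM I M)"
      by measurable
    have "emeasure (density (PiM I M) (\<lambda>x. \<Prod>i\<in>I. p i (x i))) (Pi\<^sub>E I A)
        = (\<integral>\<^sup>+x. ennreal (\<Prod>i\<in>I. p i (x i)) * indicator (Pi\<^sub>E I A) x \<partial>PiM I M)"
      using A \<open>finite I\<close> by (subst emeasure_density) (auto intro!: sets_PiM_I_finite)
    also have "\<dots> = (\<integral>\<^sup>+x. (\<Prod>i\<in>I. ennreal (p i (x i)) * indicator (A i) (x i)) \<partial>PiM I M)"
    proof (rule nn_integral_cong)
      fix x assume "x \<in> space (PiM I M)"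
      then have "indicator (Pi\<^sub>E I A) x = (\<Prod>i\<in>I. indicator (A i) (x i) :: ennreal)"
        using \<open>finite I\<close> by (auto simp: indicator_def space_PiM PiE_iff prod_zero_iff)
      then show "ennreal (\<Prod>i\<in>I. p i (x i)) * indicator (Pi\<^sub>E I A) x
          = (\<Prod>i\<in>I. ennreal (p i (x i)) * indicator (A i) (x i))"
        using nn by (simp add: prod_ennreal prod.distrib)
    qed
    also have "\<dots> = (\<Prod>i\<in>I. \<integral>\<^sup>+x. ennreal (p i x) * indicator (A i) x \<partial>M i)"
      using A \<open>finite I\<close> by (intro product_nn_integral_prod) auto
    also have "\<dots> = (\<Prod>i\<in>I. emeasure (density (M i) (p i)) (A i))"
      using A by (intro prod.cong refl) (simp add: emeasure_density)
    finally show "emeasure (density (PiM I M) (\<lambda>x. \<Prod>i\<in>I. p i (x i))) (Pi\<^sub>E I A)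
        = (\<Prod>i\<in>I. emeasure (density (M i) (p i)) (A i))" .
  qed
qed

text \<open>Independence means that the joint law is the product of the marginals, and the joint law
  of the coordinates is the product measure itself. Separate \<open>N\<close> and \<open>M\<close>
  let densities over \<open>lborel\<close> be read as laws of \<open>borel\<close>
  variables.\<close>

lemma indep_vars_PiM_component:
  assumes "I \<noteq> {}" and prob: "\<And>i. prob_space (N i)" and sets: "\<And>i. sets (N i) = sets (M i)"
  shows "prob_space.indep_vars (PiM I N) M (\<lambda>i y. y i) I"
proof -
  interpret N: product_prob_space N I using prob by (rule product_prob_spaceI)
  have sP: "sets (PiM I N) = sets (PiM I M)" by (intro sets_PiM_cong refl sets)
  have "distr (PiM I N) (PiM I M) (\<lambda>x. \<lambda>i\<in>I. x i) = distr (PiM I N) (PiM I N) (\<lambda>x. x)"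
    using sP by (intro distr_cong) (auto simp: space_PiM PiE_iff extensional_def restrict_def fun_eq_iff)
  also have "\<dots> = PiM I (\<lambda>i. distr (PiM I N) (M i) (\<lambda>y. y i))"
    unfolding distr_id
  proof (intro PiM_cong refl)
    fix i assume i: "i \<in> I"
    have "distr (PiM I N) (M i) (\<lambda>y. y i) = distr (PiM I N) (N i) (\<lambda>y. y i)"
      by (intro distr_cong refl) (simp add: sets)
    also have "\<dots> = N i" by (rule distr_PiM_component[OF prob i])
    finally show "N i = distr (PiM I N) (M i) (\<lambda>y. y i)" ..
  qed
  finally show ?thesis
    using \<open>I \<noteq> {}\<close> sP
    by (subst N.indep_vars_iff_distr_eq_PiM')
       (auto intro: measurable_component_singleton simp: measurable_cong_sets[OF sP refl])
qed

section \<open>Gaussian observations\<close>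

definition gaussian_law :: "nat \<Rightarrow> (nat \<Rightarrow> real) \<Rightarrow> real \<Rightarrow> (nat \<Rightarrow> real) measure" where
  "gaussian_law n m \<sigma> = PiM {1..n} (\<lambda>j. density lborel (normal_density (m j) \<sigma>))"

definition gaussian_density :: "nat \<Rightarrow> (nat \<Rightarrow> real) \<Rightarrow> real \<Rightarrow> (nat \<Rightarrow> real) \<Rightarrow> real" where
  "gaussian_density n m \<sigma> y = (\<Prod>j\<in>{1..n}. normal_density (m j) \<sigma> (y j))"

lemma sets_gaussian_law: "sets (gaussian_law n m \<sigma>) = sets (PiM {1..n} (\<lambda>_. borel))"
  unfolding gaussian_law_def by (intro sets_PiM_cong) auto

lemma gaussian_density_nonneg: "gaussian_density n m \<sigma> y \<ge> 0"
  unfolding gaussian_density_def by (intro prod_nonneg) auto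

lemma gaussian_density_measurable [measurable]:
  "gaussian_density n m \<sigma> \<in> borel_measurable (PiM {1..n} (\<lambda>_. lborel))"
  unfolding gaussian_density_def by measurable

lemma gaussian_law_eq_density:
  assumes "\<sigma> > 0"
  shows "gaussian_law n m \<sigma> = density (PiM {1..n} (\<lambda>_. lborel)) (gaussian_density n m \<sigma>)"
  unfolding gaussian_law_def gaussian_density_def
  by (rule density_PiM_real[symmetric])
     (auto intro: prob_space_normal_density assms simp: product_sigma_finite_def lborel.sigma_finite_measure_axioms)

lemma nn_integral_gaussian_density:
  assumes "\<sigma> > 0"
  shows "(\<integral>\<^sup>+y. gaussian_density n m \<sigma> y \<partial>PiM {1..n} (\<lambda>_. lborel)) = 1"
proof -
  interpret prob_space "gaussian_law n m \<sigma>"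
    unfolding gaussian_law_def by (intro prob_space_PiM prob_space_normal_density assms)
  show ?thesis
    using emeasure_space_1 unfolding gaussian_law_eq_density[OF assms]
    by (subst (asm) emeasure_density) (simp_all del: One_nat_def cong: nn_integral_cong)
qed

text \<open>Since (x - \<mu>)^2 + (x + \<mu>)^2 = 2 x^2 + 2 \<mu>^2, the geometric mean of the two
  densities is the centred density times a constant. That constant is the Hellinger affinity of the
  two laws.\<close>

lemma gaussian_density_opposite_means:
  assumes "\<sigma> > 0"
  shows "sqrt (gaussian_density n m \<sigma> y * gaussian_density n (\<lambda>j. - m j) \<sigma> y)
    = exp (- (\<Sum>j=1..n. (m j)\<^sup>2) / (2 * \<sigma>\<^sup>2)) * gaussian_density n (\<lambda>_. 0) \<sigma> y"
proof -
  have one: "normal_density \<mu> \<sigma> x * normal_density (- \<mu>) \<sigma> x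
      = (exp (- \<mu>\<^sup>2 / (2 * \<sigma>\<^sup>2)) * normal_density 0 \<sigma> x)\<^sup>2" for \<mu> x :: real
  proof -
    have "- (x - \<mu>)\<^sup>2 / (2 * \<sigma>\<^sup>2) + - (x - - \<mu>)\<^sup>2 / (2 * \<sigma>\<^sup>2)
        = 2 * (- \<mu>\<^sup>2 / (2 * \<sigma>\<^sup>2) + - (x - 0)\<^sup>2 / (2 * \<sigma>\<^sup>2))"
      using assms by (simp add: field_simps power2_eq_square)
    from arg_cong[OF this, of exp]
    have "exp (- (x - \<mu>)\<^sup>2 / (2 * \<sigma>\<^sup>2)) * exp (- (x - - \<mu>)\<^sup>2 / (2 * \<sigma>\<^sup>2))
        = (exp (- \<mu>\<^sup>2 / (2 * \<sigma>\<^sup>2)) * exp (- (x - 0)\<^sup>2 / (2 * \<sigma>\<^sup>2)))\<^sup>2"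
      by (simp only: exp_add exp_double)
    \<comment> \<open>Here \<open>c\<close> stands for the common normalising factor, which stays
      opaque while the identity of exponentials is carried over to densities.\<close>
    moreover have "(c * A) * (c * B) = (E * (c * D))\<^sup>2" if "A * B = (E * D)\<^sup>2" for c A B D E :: real
      using that by algebra
    ultimately show ?thesis unfolding normal_density_def by blast
  qed
  have "gaussian_density n m \<sigma> y * gaussian_density n (\<lambda>j. - m j) \<sigma> y
      = (\<Prod>j\<in>{1..n}. exp (- (m j)\<^sup>2 / (2 * \<sigma>\<^sup>2)) * normal_density 0 \<sigma> (y j))\<^sup>2"
    unfolding gaussian_density_def by (simp only: prod.distrib[symmetric] one prod_power_distrib)
  moreover have "(\<Prod>j\<in>{1..n}. exp (- (m j)\<^sup>2 / (2 * \<sigma>\<^sup>2)) * normal_density 0 \<sigma> (y j))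
      = exp (- (\<Sum>j=1..n. (m j)\<^sup>2) / (2 * \<sigma>\<^sup>2)) * gaussian_density n (\<lambda>_. 0) \<sigma> y"
    unfolding gaussian_density_def
    by (simp add: prod.distrib exp_sum[symmetric] sum_negf sum_divide_distrib[symmetric])
  ultimately show ?thesis using gaussian_density_nonneg by simp
qed

text \<open>Puts Gaussian noise of the maximal variance \<open>b\<close> at the adversary's disposal
  in the lower bound. The moments of a coordinate are those of its marginal, a Gaussian factor of
  the product.\<close>

lemma gaussian_law_in_output_laws:
  assumes "n \<ge> 1" "b > 0"
  shows "gaussian_law n (\<lambda>j. f (d j)) (sqrt b) \<in> output_laws n f (\<lambda>_. b) d"
proof -
  define P where "P = gaussian_law n (\<lambda>j. f (d j)) (sqrt b)"
  define N where "N j = density lborel (normal_density (f (d j)) (sqrt b))" for j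
  have \<sigma>: "sqrt b > 0" using assms by simp
  have N: "prob_space (N j)" for j
    unfolding N_def by (rule prob_space_normal_density[OF \<sigma>])
  have P: "P = PiM {1..n} N" by (simp only: P_def gaussian_law_def N_def[abs_def])
  interpret prob_space P unfolding P by (intro prob_space_PiM N)
  have sP: "sets P = sets (PiM {1..n} (\<lambda>_. borel))" unfolding P_def by (rule sets_gaussian_law)
  have "indep_vars (\<lambda>_. borel) (\<lambda>j y. y j) {1..n}"
    unfolding P using assms by (intro indep_vars_PiM_component N) (auto simp: N_def)
  moreover have "integrable P (\<lambda>y. y j)" "integrable P (\<lambda>y. (y j)\<^sup>2)"
      "(\<integral>y. y j \<partial>P) = f (d j)" "(\<integral>y. (y j - f (d j))\<^sup>2 \<partial>P) = b" if j: "j \<in> {1..n}" for j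
  proof -
    let ?\<mu> = "f (d j)"
    have [measurable]: "(\<lambda>y. y j) \<in> borel_measurable P"
      using j by (simp add: measurable_cong_sets[OF sP refl])
    \<comment> \<open>\<open>borel\<close>, \<open>lborel\<close> and \<open>N j\<close> have the
      same measurable sets, so the marginal may be taken over any of them.\<close>
    have "distr P borel (\<lambda>y. y j) = distr P (N j) (\<lambda>y. y j)"
      by (intro distr_cong) (auto simp: N_def)
    also have "\<dots> = N j" unfolding P by (rule distr_PiM_component[OF N j])
    finally have "distr P lborel (\<lambda>y. y j) = N j" by (simp cong: distr_cong)
    then have D: "distributed P lborel (\<lambda>y. y j) (normal_density ?\<mu> (sqrt b))"
      unfolding distributed_def by (auto simp: N_def)
    have "integrable P (\<lambda>y. y j - ?\<mu>)"
      using integrable_normal_moment[of "sqrt b" ?\<mu> 1] \<sigma>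
      by (subst distributed_integrable[OF D, symmetric]) auto
    from Bochner_Integration.integrable_add[OF this integrable_const[of ?\<mu>]]
    show i1: "integrable P (\<lambda>y. y j)" by simp
    have i2: "integrable P (\<lambda>y. (y j - ?\<mu>)\<^sup>2)"
      using integrable_normal_moment[of "sqrt b" ?\<mu> 2] \<sigma>
      by (subst distributed_integrable[OF D, symmetric]) auto
    have "(y j)\<^sup>2 = (y j - ?\<mu>)\<^sup>2 + 2 * ?\<mu> * y j - ?\<mu>\<^sup>2" for y :: "nat \<Rightarrow> real"
      by (simp add: power2_eq_square algebra_simps)
    then show "integrable P (\<lambda>y. (y j)\<^sup>2)" using i1 i2 by simp
    show "(\<integral>y. y j \<partial>P) = ?\<mu>" by (rule normal_distributed_expectation[OF \<sigma> D])
    with normal_distributed_variance[OF \<sigma> D] show "(\<integral>y. (y j - ?\<mu>)\<^sup>2 \<partial>P) = b"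
      using assms by simp
  qed
  ultimately show ?thesis
    unfolding output_laws_def using sP prob_space_axioms by (auto simp: P_def[symmetric])
qed

section \<open>The two hard functions\<close>

text \<open>
  The jump at the cutoff is harmless: the class only asks for smoothness near x0.
\<close>
definition truncated_line :: "real \<Rightarrow> real \<Rightarrow> real \<Rightarrow> real \<Rightarrow> real" where
  "truncated_line a x0 s x = (if \<bar>x - x0\<bar> \<le> sqrt (6 * \<bar>s\<bar> / a) then s * (x - x0) else 0)"

lemma truncated_line_minus: "truncated_line a x0 (- s) x = - truncated_line a x0 s x"
  by (simp add: truncated_line_def)

text \<open>Within the cutoff the squared distance to \<open>x0\<close> is at most 6 s / a. The
  bound is uniform in \<open>x\<close>, so it holds at every design point.\<close>

lemma truncated_line_square_le:
  assumes "a > 0" "s > 0"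
  shows "(truncated_line a x0 s x)\<^sup>2 \<le> 6 * s^3 / a"
proof (cases "\<bar>x - x0\<bar> \<le> sqrt (6 * s / a)")
  case True
  then have "(x - x0)\<^sup>2 \<le> 6 * s / a"
    using assms by (metis power2_abs abs_ge_zero power_mono real_sqrt_pow2 divide_nonneg_pos mult_nonneg_nonneg less_imp_le zero_le_numeral)
  then have "s\<^sup>2 * (x - x0)\<^sup>2 \<le> s\<^sup>2 * (6 * s / a)" by (intro mult_left_mono) auto
  then show ?thesis using True assms
    by (simp add: truncated_line_def power_mult_distrib power2_eq_square power3_eq_cube mult_ac)
next
  case False
  then show ?thesis using assms by (simp add: truncated_line_def)
qed

text \<open>Near \<open>x0\<close> the function is linear, so its second-order Taylor polynomial is
  s (x - x0). The remainder is 0 within the cutoff and has modulus |s| |x - x0| beyond it; the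
  cutoff radius r solves |s| r = a/6 r^3.\<close>

lemma truncated_line_in_smooth_class:
  assumes "a > 0" "s \<noteq> 0"
  shows "truncated_line a x0 s \<in> smooth_class a x0" and "deriv (truncated_line a x0 s) x0 = s"
proof -
  let ?g = "truncated_line a x0 s" and ?h = "sqrt (6 * \<bar>s\<bar> / a)"
  have h: "?h > 0" using assms by simp
  have D: "(?g has_real_derivative s) (at x)" if "x \<in> ball x0 ?h" for x
  proof -
    have "((\<lambda>x. s * (x - x0)) has_real_derivative s) (at x)"
      by (auto intro!: derivative_eq_intros)
    then show ?thesis
      by (rule has_field_derivative_transform_within_open[OF _ open_ball that])
         (auto simp: truncated_line_def dist_real_def)
  qed
  have dg: "deriv ?g x = s" if "x \<in> ball x0 ?h" for x
    using D[OF that] by (rule DERIV_imp_deriv)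
  have c: "x0 \<in> ball x0 ?h" using h by simp
  show "deriv ?g x0 = s" by (rule dg[OF c])
  \<comment> \<open>\<open>deriv ?g\<close> is constant on an open ball around \<open>x0\<close>, so
    the second derivative there is 0.\<close>
  have D2: "(deriv ?g has_real_derivative 0) (at x0)"
    by (rule has_field_derivative_transform_within_open[OF DERIV_const open_ball c]) (simp add: dg)
  have "\<forall>\<^sub>F x in nhds x0. x \<in> ball x0 ?h" using c by (intro eventually_nhds_in_open) auto
  then have "\<forall>\<^sub>F x in nhds x0. ?g differentiable (at x)"
    by eventually_elim (use D real_differentiable_def in blast)
  moreover have "deriv ?g differentiable (at x0)" using D2 real_differentiable_def by blast
  moreover have "\<bar>?g x - ?g x0 - deriv ?g x0 * (x - x0) - deriv (deriv ?g) x0 / 2 * (x - x0)\<^sup>2\<bar>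
      \<le> a / 6 * \<bar>x - x0\<bar>^3" for x
  proof (cases "\<bar>x - x0\<bar> \<le> ?h")
    case True
    then show ?thesis using assms
      by (simp add: dg[OF c] DERIV_imp_deriv[OF D2]) (simp add: truncated_line_def)
  next
    case False
    then have "?h\<^sup>2 \<le> \<bar>x - x0\<bar>\<^sup>2" using h by (intro power_mono) auto
    then have "6 * \<bar>s\<bar> / a \<le> \<bar>x - x0\<bar>\<^sup>2" using assms by simp
    then have "\<bar>s\<bar> \<le> a / 6 * \<bar>x - x0\<bar>\<^sup>2" using assms by (simp add: field_simps)
    then have "\<bar>s\<bar> * \<bar>x - x0\<bar> \<le> a / 6 * \<bar>x - x0\<bar>\<^sup>2 * \<bar>x - x0\<bar>"
      by (intro mult_right_mono) auto
    moreover have "?g x = 0" "?g x0 = 0" using False by (simp_all add: truncated_line_def)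
    ultimately show ?thesis
      by (simp add: dg[OF c] DERIV_imp_deriv[OF D2] abs_mult power3_eq_cube power2_eq_square mult_ac)
  qed
  ultimately show "?g \<in> smooth_class a x0" by (simp add: smooth_class_def)
qed

section \<open>Lower bound on the risk\<close>

lemma worst_case_mse_ge:
  assumes "f \<in> smooth_class a x0" "v \<in> variance_class b" "P \<in> output_laws n f v d"
  shows "(\<integral>\<^sup>+ y. ennreal ((\<theta> y - deriv f x0)\<^sup>2) \<partial>P) \<le> worst_case_mse a b x0 n d \<theta>"
  unfolding worst_case_mse_def using assms by (intro SUP_upper2[where i = f] SUP_upper2[where i = v] SUP_upper) auto

text \<open>The risks at slopes s and -s are both at most the worst case, and integrating the
  pointwise inequality bounds their sum below by 2 s^2 (2 G - 1) with G the affinity. The exponent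
  is the sum of n squared means, each at most 6 s^3 / a, divided by 2 b.\<close>

lemma worst_case_mse_two_point:
  assumes "a > 0" "b > 0" "n \<ge> 1" "s > 0" and \<theta>: "\<theta> \<in> estimators n"
  shows "ennreal (2 * s\<^sup>2 * (2 * exp (- (3 * real n * s^3) / (a * b)) - 1))
    \<le> 2 * worst_case_mse a b x0 n d \<theta>"
proof -
  let ?M = "PiM {1..n} (\<lambda>_::nat. lborel :: real measure)"
  define m where "m j = truncated_line a x0 s (d j)" for j
  define p where "p = gaussian_density n m (sqrt b)"
  define q where "q = gaussian_density n (\<lambda>j. - m j) (sqrt b)"
  define r where "r = gaussian_density n (\<lambda>_. 0) (sqrt b)"
  define G where "G = exp (- (\<Sum>j=1..n. (m j)\<^sup>2) / (2 * b))"
  define W where "W = worst_case_mse a b x0 n d \<theta>"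
  have \<sigma>: "sqrt b > 0" using assms by simp
  have [measurable]: "p \<in> borel_measurable ?M" "q \<in> borel_measurable ?M" "r \<in> borel_measurable ?M"
    unfolding p_def q_def r_def by measurable
  have "sets ?M = sets (PiM {1..n} (\<lambda>_. borel))" by (intro sets_PiM_cong) auto
  then have [measurable]: "\<theta> \<in> borel_measurable ?M"
    using \<theta> unfolding estimators_def by (simp cong: measurable_cong_sets)
  have nn: "p y \<ge> 0" "q y \<ge> 0" "r y \<ge> 0" for y
    by (simp_all add: p_def q_def r_def gaussian_density_nonneg)
  have int1: "(\<integral>\<^sup>+y. p y \<partial>?M) = 1" "(\<integral>\<^sup>+y. q y \<partial>?M) = 1" "(\<integral>\<^sup>+y. r y \<partial>?M) = 1"
    unfolding p_def q_def r_def by (intro nn_integral_gaussian_density \<sigma>)+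
  have law: "(\<integral>\<^sup>+y. ennreal ((\<theta> y - t)\<^sup>2 * gaussian_density n (\<lambda>j. truncated_line a x0 t (d j)) (sqrt b) y) \<partial>?M) \<le> W"
    if "t \<noteq> 0" for t
  proof -
    let ?f = "truncated_line a x0 t"
    have "(\<integral>\<^sup>+y. ennreal ((\<theta> y - t)\<^sup>2) \<partial>gaussian_law n (\<lambda>j. ?f (d j)) (sqrt b)) \<le> W"
      using worst_case_mse_ge[of ?f a x0 "\<lambda>_. b" b "gaussian_law n (\<lambda>j. ?f (d j)) (sqrt b)" n d \<theta>]
        truncated_line_in_smooth_class[of a t x0] gaussian_law_in_output_laws[of n b ?f d] assms that
      by (simp add: W_def variance_class_def)
    then show ?thesis
      unfolding gaussian_law_eq_density[OF \<sigma>]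
      by (subst (asm) nn_integral_density)
         (auto simp: ennreal_mult gaussian_density_nonneg mult.commute simp del: One_nat_def)
  qed
  have Wp: "(\<integral>\<^sup>+y. ennreal ((\<theta> y - s)\<^sup>2 * p y) \<partial>?M) \<le> W"
    using law[of s] assms by (simp add: p_def m_def[abs_def])
  have Wq: "(\<integral>\<^sup>+y. ennreal ((\<theta> y + s)\<^sup>2 * q y) \<partial>?M) \<le> W"
    using law[of "- s"] assms by (simp add: q_def m_def[abs_def] truncated_line_minus)
  \<comment> \<open>Since \<open>r\<close> integrates to 1, the constant can be spread over the
    sample space and compared with the losses pointwise.\<close>
  have "ennreal (4 * s\<^sup>2 * G) = (\<integral>\<^sup>+y. ennreal (4 * s\<^sup>2 * G) * ennreal (r y) \<partial>?M)"
    by (simp add: nn_integral_cmult int1 del: One_nat_def)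
  also have "\<dots> = (\<integral>\<^sup>+y. ennreal (4 * s\<^sup>2 * sqrt (p y * q y)) \<partial>?M)"
  proof (intro nn_integral_cong)
    fix y
    have "sqrt (p y * q y) = G * r y"
      using gaussian_density_opposite_means[OF \<sigma>, of n m y] assms by (simp add: p_def q_def r_def G_def)
    then show "ennreal (4 * s\<^sup>2 * G) * ennreal (r y) = ennreal (4 * s\<^sup>2 * sqrt (p y * q y))"
      using nn by (simp add: ennreal_mult'[symmetric] G_def mult_ac)
  qed
  also have "\<dots> \<le> (\<integral>\<^sup>+y. (ennreal ((\<theta> y - s)\<^sup>2 * p y) + ennreal ((\<theta> y + s)\<^sup>2 * q y))
      + (ennreal (s\<^sup>2) * ennreal (p y) + ennreal (s\<^sup>2) * ennreal (q y)) \<partial>?M)"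
  proof (intro nn_integral_mono)
    fix y
    have "ennreal (4 * s\<^sup>2 * sqrt (p y * q y))
        \<le> ennreal ((\<theta> y - s)\<^sup>2 * p y + (\<theta> y + s)\<^sup>2 * q y + s\<^sup>2 * (p y + q y))"
      by (intro ennreal_leI two_point_weighted_loss nn)
    then show "ennreal (4 * s\<^sup>2 * sqrt (p y * q y))
        \<le> (ennreal ((\<theta> y - s)\<^sup>2 * p y) + ennreal ((\<theta> y + s)\<^sup>2 * q y))
      + (ennreal (s\<^sup>2) * ennreal (p y) + ennreal (s\<^sup>2) * ennreal (q y))"
      using nn by (simp add: ennreal_mult'[symmetric] distrib_left)
  qed
  also have "\<dots> = ((\<integral>\<^sup>+y. ennreal ((\<theta> y - s)\<^sup>2 * p y) \<partial>?M) + (\<integral>\<^sup>+y. ennreal ((\<theta> y + s)\<^sup>2 * q y) \<partial>?M))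
      + (ennreal (s\<^sup>2) + ennreal (s\<^sup>2))"
    by (simp add: nn_integral_add nn_integral_cmult int1 del: One_nat_def)
  also have "\<dots> \<le> (W + W) + (ennreal (s\<^sup>2) + ennreal (s\<^sup>2))"
    by (intro add_mono Wp Wq order_refl)
  finally have key: "ennreal (4 * s\<^sup>2 * G) \<le> 2 * W + ennreal (2 * s\<^sup>2)"
    by (simp add: mult_2[symmetric] ennreal_mult ennreal_numeral[symmetric] del: ennreal_numeral)
  have "(\<Sum>j=1..n. (m j)\<^sup>2) \<le> (\<Sum>j=1..n. 6 * s^3 / a)"
    unfolding m_def using assms by (intro sum_mono truncated_line_square_le)
  then have "(\<Sum>j=1..n. (m j)\<^sup>2) \<le> real n * (6 * s^3 / a)" by simp
  then have "(\<Sum>j=1..n. (m j)\<^sup>2) / (2 * b) \<le> real n * (6 * s^3 / a) / (2 * b)"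
    using assms by (intro divide_right_mono) auto
  then have "exp (- (3 * real n * s^3) / (a * b)) \<le> G"
    unfolding G_def using assms by (simp add: field_simps)
  then have "4 * s\<^sup>2 * exp (- (3 * real n * s^3) / (a * b)) \<le> 4 * s\<^sup>2 * G"
    by (intro mult_left_mono) auto
  then have "2 * s\<^sup>2 * (2 * exp (- (3 * real n * s^3) / (a * b)) - 1) \<le> 4 * s\<^sup>2 * G - 2 * s\<^sup>2"
    by (simp only: right_diff_distrib mult.assoc mult.left_commute mult_2_right)
  \<comment> \<open>\<open>W\<close> may be infinite, so the finite term is moved across by
    subtraction in \<open>ennreal\<close>, where a negative real bound is read as 0.\<close>
  then have "ennreal (2 * s\<^sup>2 * (2 * exp (- (3 * real n * s^3) / (a * b)) - 1))
      \<le> ennreal (4 * s\<^sup>2 * G) - ennreal (2 * s\<^sup>2)"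
    by (subst ennreal_minus) (auto intro: ennreal_leI)
  also have "\<dots> \<le> 2 * W"
    using key by (simp add: ennreal_minus_le_iff add.commute)
  finally show ?thesis unfolding W_def .
qed

section \<open>Choice of the slope\<close>

lemma minimax_risk_ge:
  assumes "a > 0" "b > 0" "n \<ge> 1"
  shows "ennreal (1/16 * exp (-2/3) * (3 * a * b / real n) powr (2/3)) \<le> minimax_risk a b x0 n"
proof -
  define c where "c = 3 * a * b / real n"
  \<comment> \<open>This choice gives s^2 = c^(2/3) / 16, the factor in the claim, and s^3 = c / 64,
    which turns the exponent into the absolute number -9/64.\<close>
  define s where "s = 1/4 * c powr (1/3)"
  have c: "c > 0" using assms by (simp add: c_def)
  then have s: "s > 0" by (simp add: s_def)
  have s2: "s\<^sup>2 = 1/16 * c powr (2/3)"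
    using c by (simp add: s_def power_mult_distrib power2_eq_square powr_add[symmetric])
  have s3: "s^3 = c / 64"
    using c by (simp add: s_def power_mult_distrib power3_eq_cube powr_add[symmetric])
  have "3 * real n * s^3 / (a * b) = 9/64"
    using assms by (simp add: s3 c_def field_simps)
  \<comment> \<open>The value 46/64 separates the two exponentials through exp x \<ge> 1 + x: here 2
    exp (-9/64) - 1 \<ge> 2 (1 - 9/64) - 1 = 46/64, and below exp (-2/3) \<le> 3/5.\<close>
  then have e: "2 * exp (- (3 * real n * s^3) / (a * b)) - 1 \<ge> 46/64"
    using exp_ge_add_one_self[of "-9/64"] by (simp only: minus_divide_left[symmetric])
  have "exp (-2/3 :: real) \<le> 46/64"
    using exp_ge_add_one_self[of "2/3"] by (simp add: exp_minus field_simps)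
  then have "s\<^sup>2 * exp (-2/3) \<le> s\<^sup>2 * (2 * exp (- (3 * real n * s^3) / (a * b)) - 1)"
    using e by (intro mult_left_mono) auto
  then have le: "ennreal (2 * (s\<^sup>2 * exp (-2/3)))
      \<le> ennreal (2 * s\<^sup>2 * (2 * exp (- (3 * real n * s^3) / (a * b)) - 1))"
    by (intro ennreal_leI) simp
  have "ennreal (s\<^sup>2 * exp (-2/3)) \<le> worst_case_mse a b x0 n d \<theta>" if "\<theta> \<in> estimators n" for d \<theta>
  proof -
    have "2 * ennreal (s\<^sup>2 * exp (-2/3)) \<le> 2 * worst_case_mse a b x0 n d \<theta>"
      using order_trans[OF le worst_case_mse_two_point[OF assms s that]]
      by (simp add: ennreal_mult ennreal_numeral[symmetric] del: ennreal_numeral)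
    then show ?thesis by (simp add: ennreal_mult_le_mult_iff)
  qed
  then show ?thesis
    unfolding minimax_risk_def s2 c_def[symmetric]
    by (intro INF_greatest) (simp add: s2 mult_ac)
qed

section \<open>Upper bound for the CFD estimator\<close>

text \<open>In the expanded double sum, products of distinct centred independent variables have mean
  0, so only the diagonal survives.\<close>

lemma (in prob_space) indep_vars_centered_square_sum:
  fixes X :: "'i \<Rightarrow> 'a \<Rightarrow> real"
  assumes "finite I" and indep: "indep_vars (\<lambda>_. borel) X I"
    and int: "\<And>i. i \<in> I \<Longrightarrow> integrable M (X i)"
    and int2: "\<And>i. i \<in> I \<Longrightarrow> integrable M (\<lambda>x. (X i x)\<^sup>2)"
    and mean: "\<And>i. i \<in> I \<Longrightarrow> expectation (X i) = 0"
  shows "integrable M (\<lambda>x. (\<Sum>i\<in>I. X i x)\<^sup>2)" (is ?int)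
    and "expectation (\<lambda>x. (\<Sum>i\<in>I. X i x)\<^sup>2) = (\<Sum>i\<in>I. expectation (\<lambda>x. (X i x)\<^sup>2))" (is ?eq)
proof -
  have pair: "integrable M (\<lambda>x. X i x * X j x)"
      "expectation (\<lambda>x. X i x * X j x) = (if i = j then expectation (\<lambda>x. (X i x)\<^sup>2) else 0)"
    if "i \<in> I" "j \<in> I" for i j
  proof -
    have "integrable M (\<lambda>x. X i x * X j x) \<and> expectation (\<lambda>x. X i x * X j x) = 0" if "i \<noteq> j"
    proof -
      have "indep_vars (\<lambda>_. borel) X {i, j}"
        using indep \<open>i \<in> I\<close> \<open>j \<in> I\<close> by (auto intro: indep_vars_subset)
      then show ?thesis
        using indep_vars_integrable[of "{i, j}" X] indep_vars_lebesgue_integral[of "{i, j}" X]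
          int mean \<open>i \<in> I\<close> \<open>j \<in> I\<close> \<open>i \<noteq> j\<close> by auto
    qed
    then show "integrable M (\<lambda>x. X i x * X j x)"
      "expectation (\<lambda>x. X i x * X j x) = (if i = j then expectation (\<lambda>x. (X i x)\<^sup>2) else 0)"
      using int2[OF \<open>i \<in> I\<close>] by (cases "i = j"; simp add: power2_eq_square)+
  qed
  have sq: "(\<Sum>i\<in>I. X i x)\<^sup>2 = (\<Sum>i\<in>I. \<Sum>j\<in>I. X i x * X j x)" for x
    by (simp add: power2_eq_square sum_product)
  show ?int unfolding sq using pair(1) by (intro Bochner_Integration.integrable_sum) auto
  show ?eq unfolding sq using pair \<open>finite I\<close> by (simp add: Bochner_Integration.integral_sum)
qed

lemma sum_pairs_alternating:
  fixes y :: "nat \<Rightarrow> real"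
  shows "(\<Sum>j=1..m. y (2 * j - 1) - y (2 * j)) = (\<Sum>j=1..2 * m. (if odd j then 1 else -1) * y j)"
  by (induction m) simp_all

text \<open>The variance computation needs one weighted sum over all outputs; each weight has
  modulus (2/n) (1/(2 \<delta>)).\<close>

lemma cfd_estimator_linear:
  assumes "even n"
  shows "cfd_estimator n \<delta> y = (\<Sum>j=1..n. (if odd j then 1 else -1) / (real n * \<delta>) * y j)"
proof -
  have "2 * (n div 2) = n" using assms by simp
  then have "(\<Sum>j=1..n div 2. y (2 * j - 1) - y (2 * j)) = (\<Sum>j=1..n. (if odd j then 1 else -1) * y j)"
    using sum_pairs_alternating[of y "n div 2"] by simp
  then show ?thesis
    unfolding cfd_estimator_def by (simp add: sum_divide_distrib[symmetric])
qed

text \<open>By linearity this is the mean of the estimator, each output being replaced by its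
  mean.\<close>

lemma cfd_estimator_cfd_design:
  assumes "even n" "n \<ge> 1"
  shows "cfd_estimator n \<delta> (\<lambda>j. f (cfd_design x0 \<delta> j)) = (f (x0 + \<delta>) - f (x0 - \<delta>)) / (2 * \<delta>)"
proof -
  have "(\<Sum>j=1..n div 2. (f (cfd_design x0 \<delta> (2 * j - 1)) - f (cfd_design x0 \<delta> (2 * j))) / (2 * \<delta>))
      = (\<Sum>j=1..n div 2. (f (x0 + \<delta>) - f (x0 - \<delta>)) / (2 * \<delta>))"
    by (intro sum.cong) (auto simp: cfd_design_def)
  then show ?thesis
    unfolding cfd_estimator_def using assms by (auto elim!: evenE)
qed

text \<open>The quadratic terms at the two symmetric points cancel in the difference. Two remainders
  of size at most a/6 \<delta>^3 are left, divided by 2 \<delta>.\<close>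

lemma central_difference_bias:
  assumes f: "f \<in> smooth_class a x0" and \<delta>: "\<delta> > 0"
  shows "\<bar>(f (x0 + \<delta>) - f (x0 - \<delta>)) / (2 * \<delta>) - deriv f x0\<bar> \<le> a / 6 * \<delta>\<^sup>2"
proof -
  have R: "\<bar>f x - f x0 - deriv f x0 * (x - x0) - deriv (deriv f) x0 / 2 * (x - x0)\<^sup>2\<bar>
      \<le> a / 6 * \<bar>x - x0\<bar>^3" for x
    using f by (simp add: smooth_class_def)
  have "\<bar>f (x0 + \<delta>) - f x0 - deriv f x0 * \<delta> - deriv (deriv f) x0 / 2 * \<delta>\<^sup>2\<bar> \<le> a / 6 * \<delta>^3"
    "\<bar>f (x0 - \<delta>) - f x0 + deriv f x0 * \<delta> - deriv (deriv f) x0 / 2 * \<delta>\<^sup>2\<bar> \<le> a / 6 * \<delta>^3"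
    using R[of "x0 + \<delta>"] R[of "x0 - \<delta>"] \<delta> by simp_all
  then have "\<bar>f (x0 + \<delta>) - f (x0 - \<delta>) - 2 * (deriv f x0 * \<delta>)\<bar> \<le> 2 * (a / 6 * \<delta>^3)"
    by linarith
  then have "\<bar>f (x0 + \<delta>) - f (x0 - \<delta>) - deriv f x0 * (2 * \<delta>)\<bar> \<le> a / 6 * \<delta>\<^sup>2 * (2 * \<delta>)"
    by (simp add: power3_eq_cube power2_eq_square mult_ac)
  moreover have "(f (x0 + \<delta>) - f (x0 - \<delta>)) / (2 * \<delta>) - deriv f x0
      = (f (x0 + \<delta>) - f (x0 - \<delta>) - deriv f x0 * (2 * \<delta>)) / (2 * \<delta>)"
    using \<delta> by (simp add: field_simps)
  ultimately show ?thesis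
    using \<delta> by (simp add: abs_divide pos_divide_le_eq mult_ac)
qed

text \<open>The error is a centred sum of independent noises plus a deterministic bias. The noise
  contributes at most n b / (n \<delta>)^2, the bias at most the square of its Taylor bound.\<close>

lemma cfd_worst_case_mse_le:
  assumes "a > 0" "b > 0" "n \<ge> 1" "even n" "\<delta> > 0"
  shows "worst_case_mse a b x0 n (cfd_design x0 \<delta>) (cfd_estimator n \<delta>)
    \<le> ennreal (b / (real n * \<delta>\<^sup>2) + (a / 6 * \<delta>\<^sup>2)\<^sup>2)"
  unfolding worst_case_mse_def
proof (intro SUP_least)
  fix f v P
  let ?d = "cfd_design x0 \<delta>" and ?\<theta> = "cfd_estimator n \<delta>"
  assume f: "f \<in> smooth_class a x0" and v: "v \<in> variance_class b" and P: "P \<in> output_laws n f v ?d"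
  interpret prob_space P using P by (simp add: output_laws_def)
  define w where "w j = (if odd j then 1 else -1) / (real n * \<delta>)" for j :: nat
  define X where "X j y = w j * (y j - f (?d j))" for j and y :: "nat \<Rightarrow> real"
  define \<beta> where "\<beta> = (f (x0 + \<delta>) - f (x0 - \<delta>)) / (2 * \<delta>) - deriv f x0"
  have indep: "indep_vars (\<lambda>_. borel) (\<lambda>j y. y j) {1..n}"
    using P by (simp add: output_laws_def)
  have Y: "integrable P (\<lambda>y. y j)" "integrable P (\<lambda>y. (y j)\<^sup>2)"
      "(\<integral>y. y j \<partial>P) = f (?d j)" "(\<integral>y. (y j - f (?d j))\<^sup>2 \<partial>P) = v (?d j)" if "j \<in> {1..n}" for j
    using P that by (auto simp: output_laws_def)
  have indepX: "indep_vars (\<lambda>_. borel) X {1..n}"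
    using indep_vars_compose2[OF indep, of "\<lambda>j x. w j * (x - f (?d j))" "\<lambda>_. borel"]
    unfolding X_def[abs_def] by simp
  have X1: "integrable P (X j)" "expectation (X j) = 0" if "j \<in> {1..n}" for j
    unfolding X_def[abs_def] using Y[OF that] by (simp_all add: prob_space)
  have sq: "(y j - f (?d j))\<^sup>2 = (y j)\<^sup>2 - 2 * f (?d j) * y j + (f (?d j))\<^sup>2" for j and y :: "nat \<Rightarrow> real"
    by (simp add: power2_eq_square algebra_simps)
  have X2: "integrable P (\<lambda>y. (X j y)\<^sup>2)" if "j \<in> {1..n}" for j
    unfolding X_def[abs_def] power_mult_distrib sq using Y[OF that] by simp
  have EX2: "expectation (\<lambda>y. (X j y)\<^sup>2) \<le> b / (real n * \<delta>)\<^sup>2" if "j \<in> {1..n}" for j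
  proof -
    have "(w j)\<^sup>2 = 1 / (real n * \<delta>)\<^sup>2" by (simp add: w_def power_divide)
    then have "expectation (\<lambda>y. (X j y)\<^sup>2) = v (?d j) / (real n * \<delta>)\<^sup>2"
      unfolding X_def[abs_def] power_mult_distrib using Y[OF that] by simp
    also have "\<dots> \<le> b / (real n * \<delta>)\<^sup>2"
      using v by (intro divide_right_mono) (auto simp: variance_class_def)
    finally show ?thesis .
  qed
  let ?Z = "\<lambda>y. \<Sum>j=1..n. X j y"
  have Z2: "integrable P (\<lambda>y. (?Z y)\<^sup>2)"
    using indepX X1 X2 by (intro indep_vars_centered_square_sum) auto
  have "expectation (\<lambda>y. (?Z y)\<^sup>2) = (\<Sum>j=1..n. expectation (\<lambda>y. (X j y)\<^sup>2))"
    using indepX X1 X2 by (intro indep_vars_centered_square_sum) auto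
  also have "\<dots> \<le> (\<Sum>j=1..n. b / (real n * \<delta>)\<^sup>2)" by (intro sum_mono EX2)
  also have "\<dots> = b / (real n * \<delta>\<^sup>2)"
    using assms by (simp add: power_mult_distrib power2_eq_square)
  finally have EZ2: "expectation (\<lambda>y. (?Z y)\<^sup>2) \<le> b / (real n * \<delta>\<^sup>2)" .
  have Z1: "integrable P ?Z" "expectation ?Z = 0"
    using X1 by (auto simp: Bochner_Integration.integral_sum intro!: Bochner_Integration.integrable_sum)
  \<comment> \<open>\<open>?Z\<close> has mean 0, so the cross term disappears from the
    expectation.\<close>
  have err: "(?\<theta> y - deriv f x0)\<^sup>2 = (?Z y)\<^sup>2 + 2 * \<beta> * ?Z y + \<beta>\<^sup>2" for y
  proof -
    have "?Z y = ?\<theta> y - ?\<theta> (\<lambda>j. f (?d j))"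
      unfolding X_def w_def cfd_estimator_linear[OF \<open>even n\<close>]
      by (simp only: right_diff_distrib sum_subtractf)
    then have "?\<theta> y - deriv f x0 = ?Z y + \<beta>"
      using assms by (simp add: cfd_estimator_cfd_design \<beta>_def)
    then show ?thesis by (simp add: power2_eq_square algebra_simps)
  qed
  have "\<beta>\<^sup>2 \<le> (a / 6 * \<delta>\<^sup>2)\<^sup>2"
    using central_difference_bias[OF f \<open>\<delta> > 0\<close>] unfolding \<beta>_def[symmetric]
    by (metis power2_abs abs_ge_zero power_mono)
  then have "expectation (\<lambda>y. (?\<theta> y - deriv f x0)\<^sup>2) \<le> b / (real n * \<delta>\<^sup>2) + (a / 6 * \<delta>\<^sup>2)\<^sup>2"
    unfolding err using EZ2 Z1 Z2 by (simp add: prob_space)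
  moreover have "integrable P (\<lambda>y. (?\<theta> y - deriv f x0)\<^sup>2)"
    unfolding err using Z1 Z2 by simp
  ultimately show "(\<integral>\<^sup>+y. ennreal ((?\<theta> y - deriv f x0)\<^sup>2) \<partial>P)
      \<le> ennreal (b / (real n * \<delta>\<^sup>2) + (a / 6 * \<delta>\<^sup>2)\<^sup>2)"
    by (subst nn_integral_eq_integral) (auto intro: ennreal_leI)
qed

section \<open>Comparison of the two bounds\<close>

text \<open>With K = \<delta>^2 the step size minimises b / (n K) + (a K / 6)^2; there the variance
  term is a^2 K^2 / 18, twice the squared bias. The total a^2 K^2 / 12 and the lower bound are both
  fixed multiples of (a K)^2, so their ratio is an absolute constant.\<close>

lemma cfd_rate:
  assumes "a > 0" "b > 0" "n \<ge> 1"
  defines "\<delta> \<equiv> cfd_delta a b n"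
  shows "b / (real n * \<delta>\<^sup>2) + (a / 6 * \<delta>\<^sup>2)\<^sup>2
    = (4/3 * 6 powr (2/3) * exp (2/3)) * (1/16 * exp (-2/3) * (3 * a * b / real n) powr (2/3))"
proof -
  define K where "K = \<delta>\<^sup>2"
  have n: "real n > 0" using assms by simp
  have \<delta>: "\<delta> = (18 * b / (a\<^sup>2 * real n)) powr (1/6)"
    unfolding \<delta>_def cfd_delta_def using assms
    by (simp add: powr_mult powr_divide powr_minus divide_simps)
  have "\<delta> > 0" unfolding \<delta> using assms(1,2) n by simp
  then have K: "K > 0" by (simp add: K_def)
  have "K^3 = \<delta>^6" by (simp add: K_def power_mult[symmetric])
  also have "\<dots> = 18 * b / (a\<^sup>2 * real n)"
    unfolding \<delta> using assms n by (simp add: powr_power)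
  finally have K3: "K^3 = 18 * b / (a\<^sup>2 * real n)" .
  then have "b / real n = a\<^sup>2 * K^3 / 18" using assms by (simp add: field_simps)
  then have "b / real n / K = a\<^sup>2 * K^3 / 18 / K" by (rule arg_cong)
  then have "b / (real n * K) = a\<^sup>2 * K\<^sup>2 / 18"
    using K by (simp add: power3_eq_cube power2_eq_square)
  then have L: "b / (real n * K) + (a / 6 * K)\<^sup>2 = a\<^sup>2 * K\<^sup>2 / 12"
    by (simp only: power_mult_distrib power_divide) simp
  have "3 * a * b / real n = (a * K)^3 / 6"
    unfolding power_mult_distrib K3 using assms(1,2) n
    by (simp add: power2_eq_square power3_eq_cube)
  then have "(3 * a * b / real n) powr (2/3) = ((a * K)^3) powr (2/3) / 6 powr (2/3)"
    using assms K by (simp only: powr_divide)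
  also have "((a * K)^3) powr (2/3) = ((a * K) powr 3) powr (2/3)"
    using assms K by (simp add: powr_numeral)
  also have "\<dots> = (a * K) powr 2" by (simp add: powr_powr)
  also have "\<dots> = (a * K)\<^sup>2" using assms K by (simp add: powr_numeral)
  finally have R: "(3 * a * b / real n) powr (2/3) = (a * K)\<^sup>2 / 6 powr (2/3)" .
  have "exp (2/3 :: real) * exp (-2/3) = 1" by (simp add: exp_minus)
  then have "(4/3 * 6 powr (2/3) * exp (2/3)) * (1/16 * exp (-2/3) * ((a * K)\<^sup>2 / 6 powr (2/3)))
      = (a * K)\<^sup>2 / 12"
    by simp
  then show ?thesis unfolding R using L by (simp add: K_def power_mult_distrib)
qed

theorem theorem4:
  shows "(\<forall>(a::real) (b::real) (x0::real) (n::nat). a > 0 \<longrightarrow> b > 0 \<longrightarrow> n \<ge> 1 \<longrightarrow>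
            minimax_risk a b x0 n
              \<ge> ennreal (1/16 * exp (-2/3) * (3 * a * b / real n) powr (2/3)))
       \<and> (\<exists>C::real. C > 0 \<and>
            (\<forall>(a::real) (b::real) (x0::real) (n::nat). a > 0 \<longrightarrow> b > 0 \<longrightarrow> n \<ge> 1 \<longrightarrow> even n \<longrightarrow>
               worst_case_mse a b x0 n
                   (cfd_design x0 (cfd_delta a b n)) (cfd_estimator n (cfd_delta a b n))
                 \<le> ennreal C * minimax_risk a b x0 n))"
\<comment> \<open>The witness is the exact ratio from \<open>cfd_rate\<close> of the CFD bound to
  the lower bound.\<close>
proof (intro conjI exI[of _ "4/3 * 6 powr (2/3) * exp (2/3)"] allI impI)
  fix a b x0 :: real and n :: nat
  assume pos: "a > 0" "b > 0" "n \<ge> 1" and "even n"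
  let ?C = "4/3 * 6 powr (2/3) * exp (2/3) :: real"
  have "cfd_delta a b n > 0" using pos by (simp add: cfd_delta_def)
  from cfd_worst_case_mse_le[OF pos \<open>even n\<close> this]
  have "worst_case_mse a b x0 n (cfd_design x0 (cfd_delta a b n)) (cfd_estimator n (cfd_delta a b n))
      \<le> ennreal ?C * ennreal (1/16 * exp (-2/3) * (3 * a * b / real n) powr (2/3))"
    unfolding cfd_rate[OF pos] by (subst ennreal_mult[symmetric]) simp_all
  also have "\<dots> \<le> ennreal ?C * minimax_risk a b x0 n"
    by (intro mult_left_mono minimax_risk_ge pos) simp
  finally show "worst_case_mse a b x0 n
      (cfd_design x0 (cfd_delta a b n)) (cfd_estimator n (cfd_delta a b n))
      \<le> ennreal ?C * minimax_risk a b x0 n" .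
qed (rule minimax_risk_ge, assumption+, simp)

end
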